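(* Let $N\ge 1$, $\mathbf h=[h_1,\dots,h_N]^T\in\mathbb C^N$ with all $h_i\ne 0$, and let $\sigma_\theta^2,\sigma_w^2,\sigma_{v,i}^2,P_{T,i}>0$ ($i=1,\dots,N$) and $P>0$. Consider the semidefinite program $$\max_{\bar{\mathbf A}}\ \mathrm{tr}(\bar{\mathbf A}\bar{\mathbf H})\quad\text{s.t.}\quad \mathrm{tr}(\bar{\mathbf A}\bar{\mathbf C})=1,\quad \mathrm{tr}(\bar{\mathbf A}\bar{\mathbf D}_i)\le 0\ (i=1,\dots,N),\quad \bar{\mathbf A}\succeq 0,$$ over Hermitian $(N+1)\times(N+1)$ matrices $\bar{\mathbf A}$, where $\bar{\mathbf H},\bar{\mathbf C},\bar{\mathbf D}_i$ are the matrices given in the context. Let $\bar{\mathbf A}^*$ be an optimal solution of this program, let $\bar{\mathbf A}^*_N$ be its leading principal $N\times N$ submatrix and $\bar{\mathbf A}^*_{N+1,N+1}$ its last diagonal entry. Then $\bar{\mathbf A}^*_N$ has rank one, $\bar{\mathbf A}_N^*=\mathbf a\mathbf a^H$ for some $\mathbf a\in\mathbb C^N$, and $$\mathbf a^*=\frac{1}{\sqrt{\bar{\mathbf A}^*_{N+1,N+1}}}\,\mathbf a$$ is an optimal solution of the problem $$\min_{\mathbf a=[a_1,\dots,a_N]^H\in\mathbb C^N}\ \mathrm{MSE}(\mathbf a)\quad\text{s.t.}\quad |a_i|^2(\sigma_\theta^2+\sigma_{v,i}^2)\le P_{T,i},\quad i=1,\dots,N,$$ where $$\mathrm{MSE}(\mathbf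 a)=\left(1-\frac{P\,\mathbf a^H\mathbf h\mathbf h^H\mathbf a}{\mathbf a^H\mathbf H\mathbf V\mathbf H^H\mathbf a+P\,\mathbf a^H\mathbf h\mathbf h^H\mathbf a+\sigma_w^2}\right)P .$$
   Context: $(\cdot)^H$ is the conjugate transpose. $\mathbf H=\mathrm{diag}\{h_1,\dots,h_N\}$, $\mathbf V=\mathrm{diag}\{\sigma_{v,1}^2,\dots,\sigma_{v,N}^2\}$, and $\mathbf D_i$ is the $N\times N$ diagonal matrix whose only nonzero entry is $\sigma_\theta^2+\sigma_{v,i}^2$ in position $(i,i)$. The $(N+1)\times(N+1)$ matrices are $$\bar{\mathbf H}=\begin{bmatrix}\mathbf h\mathbf h^H&\mathbf 0\\ \mathbf 0^T&0\end{bmatrix},\quad \bar{\mathbf C}=\begin{bmatrix}\mathbf H\mathbf V\mathbf H^H&\mathbf 0\\ \mathbf 0^T&\sigma_w^2\end{bmatrix},\quad \bar{\mathbf D}_i=\begin{bmatrix}\mathbf D_i&\mathbf 0\\ \mathbf 0^T&-P_{T,i}\end{bmatrix}.$$ Setting: $\mathrm{MSE}(\mathbf a)$ is the filtered Kalman MSE $P_{n|n}$ at a fusion center (prediction MSE $P=P_{n|n-1}$, noise variance $\sigma_w^2$) receiving coherently summed amplified observations from $N$ sensors with channels $h_i$, measurement noise variances $\sigma_{v,i}^2$ and individual power budgets $P_{T,i}$. *)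

theory Defs
  imports
    "Jordan_Normal_Form.DL_Rank_Submatrix"
    "Jordan_Normal_Form.Schur_Decomposition"
begin

definition mat_trace :: "'a::comm_monoid_add mat \<Rightarrow> 'a" where
  "mat_trace A = (\<Sum>i<dim_row A. A $$ (i, i))"

definition hermitian_mat :: "nat \<Rightarrow> complex mat \<Rightarrow> bool" where
  "hermitian_mat n A \<longleftrightarrow> A \<in> carrier_mat n n \<and> mat_adjoint A = A"

text \<open>The quadratic form $x^H A x$. It is real for Hermitian $A$; the same holds for the
  trace of a product of two Hermitian matrices. Below, \<^const>\<open>Re\<close> only turns such numbers
  into elements of \<^typ>\<open>real\<close>.\<close>

definition quad_form :: "complex mat \<Rightarrow> complex vec \<Rightarrow> complex" where
  "quad_form A x = (A *\<^sub>v x) \<bullet>c x"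

definition psd_mat :: "nat \<Rightarrow> complex mat \<Rightarrow> bool" where
  "psd_mat n A \<longleftrightarrow> hermitian_mat n A \<and> (\<forall>x \<in> carrier_vec n. 0 \<le> Re (quad_form A x))"

text \<open>The rank-one product $v v^H$.\<close>

definition outer_mat :: "complex vec \<Rightarrow> complex mat" where
  "outer_mat v = mat (dim_vec v) (dim_vec v) (\<lambda>(i, j). v $ i * cnj (v $ j))"

text \<open>Sensors are numbered $0, \dots, N-1$, where $N$ is the dimension of \<open>h\<close>. The arguments
  \<open>\<sigma>\<theta>\<close>, \<open>\<sigma>v\<close>, \<open>\<sigma>w\<close> are standard deviations; only their squares are used.\<close>

definition HVH :: "complex vec \<Rightarrow> (nat \<Rightarrow> real) \<Rightarrow> complex mat" where
  "HVH h \<sigma>v =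
     (let H = mat_diag (dim_vec h) (\<lambda>i. h $ i);
          V = mat_diag (dim_vec h) (\<lambda>i. complex_of_real ((\<sigma>v i)\<^sup>2))
      in H * V * mat_adjoint H)"

definition D_mat :: "nat \<Rightarrow> real \<Rightarrow> (nat \<Rightarrow> real) \<Rightarrow> nat \<Rightarrow> complex mat" where
  "D_mat N \<sigma>\<theta> \<sigma>v i =
     mat_diag N (\<lambda>k. if k = i then complex_of_real (\<sigma>\<theta>\<^sup>2 + (\<sigma>v i)\<^sup>2) else 0)"

text \<open>The block matrix with diagonal blocks \<open>A\<close> (of size $N \times N$) and \<open>c\<close>
  (of size $1 \times 1$) and zero off-diagonal blocks.\<close>

definition border_mat :: "nat \<Rightarrow> complex mat \<Rightarrow> real \<Rightarrow> complex mat" where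
  "border_mat N A c =
     four_block_mat A (0\<^sub>m N 1) (0\<^sub>m 1 N) (mat 1 1 (\<lambda>_. complex_of_real c))"

definition H_bar :: "complex vec \<Rightarrow> complex mat" where
  "H_bar h = border_mat (dim_vec h) (outer_mat h) 0"

definition C_bar :: "complex vec \<Rightarrow> (nat \<Rightarrow> real) \<Rightarrow> real \<Rightarrow> complex mat" where
  "C_bar h \<sigma>v \<sigma>w = border_mat (dim_vec h) (HVH h \<sigma>v) (\<sigma>w\<^sup>2)"

definition D_bar ::
  "nat \<Rightarrow> real \<Rightarrow> (nat \<Rightarrow> real) \<Rightarrow> (nat \<Rightarrow> real) \<Rightarrow> nat \<Rightarrow> complex mat" where
  "D_bar N \<sigma>\<theta> \<sigma>v PT i = border_mat N (D_mat N \<sigma>\<theta> \<sigma>v i) (- PT i)"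

definition sdp_feasible ::
  "complex vec \<Rightarrow> real \<Rightarrow> (nat \<Rightarrow> real) \<Rightarrow> real \<Rightarrow> (nat \<Rightarrow> real) \<Rightarrow> complex mat \<Rightarrow> bool" where
  "sdp_feasible h \<sigma>\<theta> \<sigma>v \<sigma>w PT A \<longleftrightarrow>
     psd_mat (dim_vec h + 1) A \<and>
     mat_trace (A * C_bar h \<sigma>v \<sigma>w) = 1 \<and>
     (\<forall>i < dim_vec h. Re (mat_trace (A * D_bar (dim_vec h) \<sigma>\<theta> \<sigma>v PT i)) \<le> 0)"

definition sdp_optimal ::
  "complex vec \<Rightarrow> real \<Rightarrow> (nat \<Rightarrow> real) \<Rightarrow> real \<Rightarrow> (nat \<Rightarrow> real) \<Rightarrow> complex mat \<Rightarrow> bool" where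
  "sdp_optimal h \<sigma>\<theta> \<sigma>v \<sigma>w PT =
     is_arg_max (\<lambda>A. Re (mat_trace (A * H_bar h))) (sdp_feasible h \<sigma>\<theta> \<sigma>v \<sigma>w PT)"

definition MSE ::
  "complex vec \<Rightarrow> (nat \<Rightarrow> real) \<Rightarrow> real \<Rightarrow> real \<Rightarrow> complex vec \<Rightarrow> real" where
  "MSE h \<sigma>v \<sigma>w P a =
     (1 - P * Re (quad_form (outer_mat h) a) /
          (Re (quad_form (HVH h \<sigma>v) a) + P * Re (quad_form (outer_mat h) a) + \<sigma>w\<^sup>2)) * P"

text \<open>The gains $a_i$ of the sensors are collected in $a = [a_1, \dots, a_N]^H$, so that $a_i$ is
  the conjugate of the $i$-th entry of the vector.\<close>

definition power_feasible ::
  "nat \<Rightarrow> real \<Rightarrow> (nat \<Rightarrow> real) \<Rightarrow> (nat \<Rightarrow> real) \<Rightarrow> complex vec \<Rightarrow> bool" where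
  "power_feasible N \<sigma>\<theta> \<sigma>v PT a \<longleftrightarrow>
     a \<in> carrier_vec N \<and>
     (\<forall>i<N. (cmod (conjugate a $ i))\<^sup>2 * (\<sigma>\<theta>\<^sup>2 + (\<sigma>v i)\<^sup>2) \<le> PT i)"

definition mse_optimal ::
  "complex vec \<Rightarrow> real \<Rightarrow> (nat \<Rightarrow> real) \<Rightarrow> real \<Rightarrow> (nat \<Rightarrow> real) \<Rightarrow> real \<Rightarrow> complex vec \<Rightarrow> bool" where
  "mse_optimal h \<sigma>\<theta> \<sigma>v \<sigma>w PT P =
     is_arg_min (MSE h \<sigma>v \<sigma>w P) (power_feasible (dim_vec h) \<sigma>\<theta> \<sigma>v PT)"

end

theory Submission
  imports Defs
begin

text \<open>Let \<open>b\<^sub>i\<close> be the square root of \<open>A\<^sub>i\<^sub>i\<close>. Positive semidefiniteness gives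
  \<open>\<bar>A\<^sub>i\<^sub>j\<bar> \<le> b\<^sub>i b\<^sub>j\<close>, so the objective is at most \<open>(\<Sum>i. \<bar>h\<^sub>i\<bar> b\<^sub>i)\<^sup>2\<close>. The constraints involve only
  the diagonal, and the rank-one block built from the vector with entries
  \<open>b\<^sub>i h\<^sub>i / \<bar>h\<^sub>i\<bar>\<close> has the same diagonal and attains this bound. An optimal \<open>A\<close> must
  therefore attain it too, and equality in every summand forces \<open>A\<close> to have this very
  leading block. After the Charnes-Cooper scaling by the last diagonal entry, the objective
  becomes the ratio of signal power to noise power, of which the MSE is a decreasing
  function.\<close>

section \<open>Entries, traces and quadratic forms in coordinates\<close>

lemma submatrix_lessThan:
  assumes "N \<le> dim_row A" and "N \<le> dim_col A"
  shows "submatrix A {..<N} {..<N} = mat N N (\<lambda>ij. A $$ ij)"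
proof (rule eq_matI)
  have row: "{i. i < dim_row A \<and> i \<in> {..<N}} = {..<N}"
    and col: "{j. j < dim_col A \<and> j \<in> {..<N}} = {..<N}"
    using assms by auto
  then show "dim_row (submatrix A {..<N} {..<N}) = dim_row (mat N N (\<lambda>ij. A $$ ij))"
    and "dim_col (submatrix A {..<N} {..<N}) = dim_col (mat N N (\<lambda>ij. A $$ ij))"
    by (simp_all add: dim_submatrix)
  fix i j
  assume "i < dim_row (mat N N (\<lambda>ij. A $$ ij))" and "j < dim_col (mat N N (\<lambda>ij. A $$ ij))"
  then have ij: "i < N" "j < N" by auto
  \<comment> \<open>\<open>submatrix_index_card\<close> addresses a selected entry by the number of
    selected indices below it; for an initial segment this count is the index itself.\<close>
  have "{a \<in> {..<N}. a < k} = {..<k}" if "k < N" for k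
    using that by auto
  then show "submatrix A {..<N} {..<N} $$ (i, j) = mat N N (\<lambda>ij. A $$ ij) $$ (i, j)"
    using submatrix_index_card[of i A j "{..<N}" "{..<N}"] ij assms by simp
qed

lemma quad_form_eq_sum:
  assumes "A \<in> carrier_mat n n" and "x \<in> carrier_vec n"
  shows "quad_form A x = (\<Sum>i<n. \<Sum>j<n. A $$ (i, j) * x $ j * cnj (x $ i))"
  using assms
  by (auto simp: quad_form_def scalar_prod_def sum_distrib_right atLeast0LessThan intro!: sum.cong)

lemma mat_adjoint_carrier: "A \<in> carrier_mat n m \<Longrightarrow> mat_adjoint A \<in> carrier_mat m n"
  by (auto simp: mat_adjoint_def mat_of_rows_def)

lemma mat_adjoint_index:
  "A \<in> carrier_mat n m \<Longrightarrow> i < m \<Longrightarrow> j < n \<Longrightarrow> mat_adjoint A $$ (i, j) = conjugate (A $$ (j, i))"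
  by (auto simp: mat_adjoint_def mat_of_rows_def)

lemma hermitian_mat_iff:
  "hermitian_mat n A \<longleftrightarrow>
     A \<in> carrier_mat n n \<and> (\<forall>i<n. \<forall>j<n. A $$ (i, j) = cnj (A $$ (j, i)))"
proof (intro iffI conjI)
  assume *: "hermitian_mat n A"
  then show A: "A \<in> carrier_mat n n"
    by (simp add: hermitian_mat_def)
  from * have "mat_adjoint A = A"
    by (simp add: hermitian_mat_def)
  then show "\<forall>i<n. \<forall>j<n. A $$ (i, j) = cnj (A $$ (j, i))"
    using mat_adjoint_index[OF A] by (metis conjugate_complex_def)
next
  assume *: "A \<in> carrier_mat n n \<and> (\<forall>i<n. \<forall>j<n. A $$ (i, j) = cnj (A $$ (j, i)))"
  then have A: "A \<in> carrier_mat n n" ..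
  have "mat_adjoint A = A"
  proof (rule eq_matI)
    fix i j
    assume "i < dim_row A" and "j < dim_col A"
    then have "i < n" "j < n" using A by auto
    then show "mat_adjoint A $$ (i, j) = A $$ (i, j)"
      using * mat_adjoint_index[OF A] by (metis conjugate_complex_def)
  qed (use A mat_adjoint_carrier[OF A] in auto)
  then show "hermitian_mat n A"
    using A by (simp add: hermitian_mat_def)
qed

text \<open>A product of diagonal matrices is taken entrywise, and the phases of \<open>h\<close>
  cancel against their conjugates. The noise term therefore sees only the diagonal of a
  matrix.\<close>

lemma HVH_eq:
  "HVH h \<sigma>v = mat_diag (dim_vec h) (\<lambda>i. complex_of_real ((cmod (h $ i))\<^sup>2 * (\<sigma>v i)\<^sup>2))"
proof -
  have "mat_adjoint (mat_diag n f) = mat_diag n (\<lambda>i. cnj (f i))" for n f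
  proof (rule eq_matI)
    fix i j
    assume "i < dim_row (mat_diag n (\<lambda>i. cnj (f i)))" and "j < dim_col (mat_diag n (\<lambda>i. cnj (f i)))"
    then have "i < n" "j < n" by (simp_all add: mat_diag_def)
    then show "mat_adjoint (mat_diag n f) $$ (i, j) = mat_diag n (\<lambda>i. cnj (f i)) $$ (i, j)"
      by (simp add: mat_adjoint_index[OF mat_diag_dim]) (simp add: mat_diag_def)
  qed (simp_all add: mat_adjoint_def mat_diag_def)
  moreover have "h $ i * complex_of_real ((\<sigma>v i)\<^sup>2) * cnj (h $ i) =
      complex_of_real ((cmod (h $ i))\<^sup>2 * (\<sigma>v i)\<^sup>2)" for i
    unfolding of_real_mult complex_norm_square by (rule mult.assoc[THEN trans]) (simp only: mult_ac)
  ultimately show ?thesis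
    unfolding HVH_def Let_def by (simp only: mat_diag_diag)
qed

lemma mat_trace_mult:
  assumes "A \<in> carrier_mat n m" and "B \<in> carrier_mat m n"
  shows "mat_trace (A * B) = (\<Sum>i<n. \<Sum>j<m. A $$ (i, j) * B $$ (j, i))"
  using assms
  by (auto simp: mat_trace_def scalar_prod_def atLeast0LessThan intro!: sum.cong)

lemma border_mat_carrier:
  "M \<in> carrier_mat N N \<Longrightarrow> border_mat N M c \<in> carrier_mat (N + 1) (N + 1)"
  by (auto simp: border_mat_def)

lemma border_mat_index:
  assumes "M \<in> carrier_mat N N" and "i \<le> N" and "j \<le> N"
  shows "border_mat N M c $$ (i, j) =
    (if i < N \<and> j < N then M $$ (i, j) else if i = N \<and> j = N then complex_of_real c else 0)"
  using assms by (auto simp: border_mat_def)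

lemma mat_trace_mult_border_mat:
  assumes "A \<in> carrier_mat (N + 1) (N + 1)" and "M \<in> carrier_mat N N"
  shows "mat_trace (A * border_mat N M c) =
    (\<Sum>i<N. \<Sum>j<N. A $$ (i, j) * M $$ (j, i)) + A $$ (N, N) * complex_of_real c"
  using assms
  by (simp add: mat_trace_mult[OF assms(1) border_mat_carrier] border_mat_index)

lemma outer_mat_carrier: "v \<in> carrier_vec n \<Longrightarrow> outer_mat v \<in> carrier_mat n n"
  by (auto simp: outer_mat_def)

lemma outer_mat_index:
  "v \<in> carrier_vec n \<Longrightarrow> i < n \<Longrightarrow> j < n \<Longrightarrow> outer_mat v $$ (i, j) = v $ i * cnj (v $ j)"
  by (auto simp: outer_mat_def)

lemma quad_form_outer_mat:
  assumes "v \<in> carrier_vec n" and "x \<in> carrier_vec n"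
  shows "quad_form (outer_mat v) x = complex_of_real ((cmod (\<Sum>i<n. v $ i * cnj (x $ i)))\<^sup>2)"
  unfolding quad_form_eq_sum[OF outer_mat_carrier[OF assms(1)] assms(2)] complex_norm_square
  by (auto simp: sum_product outer_mat_index[OF assms(1)] intro!: sum.cong)

lemma quad_form_mat_diag:
  assumes "x \<in> carrier_vec n"
  shows "quad_form (mat_diag n f) x = (\<Sum>i<n. f i * complex_of_real ((cmod (x $ i))\<^sup>2))"
proof -
  have "(\<Sum>j<n. mat_diag n f $$ (i, j) * x $ j * cnj (x $ i)) = f i * (x $ i * cnj (x $ i))"
    if "i < n" for i
  proof -
    have "(\<Sum>j<n. mat_diag n f $$ (i, j) * x $ j * cnj (x $ i)) =
        (\<Sum>j<n. if j = i then f i * (x $ i * cnj (x $ i)) else 0)"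
      using that by (intro sum.cong) (auto simp: mat_diag_def)
    then show ?thesis using that by simp
  qed
  then show ?thesis
    unfolding quad_form_eq_sum[OF mat_diag_dim assms] complex_norm_square by simp
qed

section \<open>Positive semidefinite matrices\<close>

text \<open>The quadratic form splits into a squared modulus and \<open>c\<close> times the squared
  modulus of the last coordinate. Both comparison matrices for the semidefinite program have this
  shape.\<close>

lemma psd_mat_border_outer_mat:
  assumes v: "v \<in> carrier_vec N" and c: "c \<ge> 0"
  shows "psd_mat (N + 1) (border_mat N (outer_mat v) c)"
  unfolding psd_mat_def
proof (intro conjI ballI)
  note oc = outer_mat_carrier[OF v]
  show "hermitian_mat (N + 1) (border_mat N (outer_mat v) c)"
    using border_mat_carrier[OF oc]
    by (auto simp: hermitian_mat_iff border_mat_index[OF oc] outer_mat_index[OF v])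
  fix x :: "complex vec"
  assume x: "x \<in> carrier_vec (N + 1)"
  let ?x = "vec N (\<lambda>i. x $ i)"
  have "quad_form (border_mat N (outer_mat v) c) x =
      quad_form (outer_mat v) ?x + complex_of_real (c * (cmod (x $ N))\<^sup>2)"
    unfolding of_real_mult complex_norm_square
    by (simp add: quad_form_eq_sum[OF border_mat_carrier[OF oc] x] quad_form_eq_sum[OF oc, of ?x]
        border_mat_index[OF oc])
  then show "0 \<le> Re (quad_form (border_mat N (outer_mat v) c) x)"
    using c by (simp add: quad_form_outer_mat[OF v])
qed

lemma psd_mat_carrier: "psd_mat n A \<Longrightarrow> A \<in> carrier_mat n n"
  by (simp add: psd_mat_def hermitian_mat_def)

lemma psd_mat_cnj: "psd_mat n A \<Longrightarrow> i < n \<Longrightarrow> j < n \<Longrightarrow> A $$ (i, j) = cnj (A $$ (j, i))"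
  unfolding psd_mat_def hermitian_mat_iff by blast

lemma psd_mat_diag:
  assumes "psd_mat n A" and "i < n"
  shows "A $$ (i, i) = complex_of_real (Re (A $$ (i, i)))" and "Re (A $$ (i, i)) \<ge> 0"
proof -
  show "A $$ (i, i) = complex_of_real (Re (A $$ (i, i)))"
    using psd_mat_cnj[OF assms assms(2)] by (metis Reals_cnj_iff of_real_Re)
  have A: "A \<in> carrier_mat n n" by (rule psd_mat_carrier[OF assms(1)])
  have "quad_form A (unit_vec n i) = A $$ (i, i)"
  proof -
    have "(\<Sum>l<n. A $$ (k, l) * unit_vec n i $ l * cnj (unit_vec n i $ k)) =
        (\<Sum>l<n. if l = i then if k = i then A $$ (i, i) else 0 else 0)" if "k < n" for k
      using that assms(2) by (intro sum.cong) auto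
    then show ?thesis
      using assms(2) by (simp add: quad_form_eq_sum[OF A])
  qed
  then show "Re (A $$ (i, i)) \<ge> 0"
    using assms by (metis psd_mat_def unit_vec_carrier)
qed

text \<open>This is nonnegativity of the 2 by 2 principal minors, obtained by testing the form on
  vectors supported on \<open>i\<close> and \<open>j\<close>. It bounds the objective summand by
  summand.\<close>

lemma psd_mat_entry_bound:
  assumes psd: "psd_mat n A" and i: "i < n" and j: "j < n"
  shows "cmod (A $$ (i, j)) \<le> sqrt (Re (A $$ (i, i))) * sqrt (Re (A $$ (j, j)))"
proof (cases "i = j")
  case True
  then show ?thesis
    using psd_mat_diag[OF psd i] by (metis norm_of_real abs_of_nonneg order_refl real_sqrt_mult_self)
next
  case False
  note A = psd_mat_carrier[OF psd] and herm = psd_mat_cnj[OF psd j i]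
  define p q r where "p = Re (A $$ (i, i))" and "q = Re (A $$ (j, j))" and "r = cmod (A $$ (i, j))"
  have p: "p \<ge> 0" "A $$ (i, i) = complex_of_real p" and q: "q \<ge> 0" "A $$ (j, j) = complex_of_real q"
    using psd_mat_diag[OF psd] i j by (auto simp: p_def q_def)
  \<comment> \<open>Polar form of the entry; the phase of a zero entry is arbitrary and set to
    1.\<close>
  obtain w where w: "cmod w = 1" "A $$ (i, j) = complex_of_real r * w"
  proof (cases "A $$ (i, j) = 0")
    case True
    then show thesis by (intro that[of 1]) (simp_all add: r_def)
  next
    case False
    then show thesis by (intro that[of "sgn (A $$ (i, j))"]) (simp_all add: r_def sgn_eq norm_divide)
  qed
  then have ww: "w * cnj w = 1"
    by (simp flip: complex_norm_square)
  \<comment> \<open>The quadratic form at \<open>s w e\<^sub>i - t e\<^sub>j\<close>: the phase \<open>w\<close> aligns the cross terms.\<close>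
  have form: "2 * s * t * r \<le> s\<^sup>2 * p + t\<^sup>2 * q" for s t :: real
  proof -
    define x where "x = vec n (\<lambda>k. if k = i then complex_of_real s * w
      else if k = j then - complex_of_real t else 0)"
    have x: "x \<in> carrier_vec n" by (simp add: x_def)
    have xi: "x $ i = complex_of_real s * w" "x $ j = - complex_of_real t"
      and x0: "\<And>k. k < n \<Longrightarrow> k \<noteq> i \<Longrightarrow> k \<noteq> j \<Longrightarrow> x $ k = 0"
      using i j False by (simp_all add: x_def)
    have two: "(\<Sum>k<n. f k) = f i + f j" if "\<And>k. k < n \<Longrightarrow> k \<noteq> i \<Longrightarrow> k \<noteq> j \<Longrightarrow> f k = 0"
      for f :: "nat \<Rightarrow> complex"
    proof -
      have "(\<Sum>k<n. f k) = (\<Sum>k\<in>{i, j}. f k)"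
        using that i j by (intro sum.mono_neutral_right) auto
      then show ?thesis using False by simp
    qed
    have "quad_form A x = (\<Sum>k<n. A $$ (k, i) * x $ i * cnj (x $ k) + A $$ (k, j) * x $ j * cnj (x $ k))"
      unfolding quad_form_eq_sum[OF A x] by (intro sum.cong refl two) (simp add: x0)
    also have "\<dots> = A $$ (i, i) * x $ i * cnj (x $ i) + A $$ (i, j) * x $ j * cnj (x $ i)
        + (A $$ (j, i) * x $ i * cnj (x $ j) + A $$ (j, j) * x $ j * cnj (x $ j))"
      by (rule two) (simp add: x0)
    also have "\<dots> = complex_of_real (s\<^sup>2 * p) * (w * cnj w) - 2 * complex_of_real (s * t * r) * (w * cnj w)
        + complex_of_real (t\<^sup>2 * q)"
      by (simp add: xi p(2) q(2) herm w(2) power2_eq_square algebra_simps)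
    also have "\<dots> = complex_of_real (s\<^sup>2 * p - 2 * s * t * r + t\<^sup>2 * q)"
      by (simp add: ww)
    finally have "Re (quad_form A x) = s\<^sup>2 * p - 2 * s * t * r + t\<^sup>2 * q"
      by simp
    moreover have "Re (quad_form A x) \<ge> 0"
      using psd x by (simp add: psd_mat_def)
    ultimately show ?thesis by simp
  qed
  have "r\<^sup>2 \<le> p * q"
  proof (cases "p = 0")
    case True
    have "r = 0"
    proof (rule ccontr)
      assume "r \<noteq> 0"
      then have "r > 0" by (simp add: r_def)
      then show False
        \<comment> \<open>With \<open>p = 0\<close> the inequality is linear in \<open>s\<close>;
          this choice would give 2(q + 1) \<le> q.\<close>
        using form[of "(q + 1) / r" 1] True q(1) by simp
    qed
    then show ?thesis using True by simp
  next
    case False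
    then show ?thesis
      \<comment> \<open>For \<open>t = p\<close> the quadratic in \<open>s\<close> is minimal at
        \<open>s = r\<close>; what remains is p times the claim, and p is positive here.\<close>
      using form[of r p] p(1) by (simp add: power2_eq_square algebra_simps)
  qed
  then show ?thesis
    using real_le_rsqrt[of r "p * q"] by (simp add: p_def q_def r_def real_sqrt_mult)
qed

section \<open>Rank of an outer product\<close>

text \<open>All columns are multiples of column \<open>k\<close>, which is nonzero because its entry
  \<open>k\<close> is the squared modulus of \<open>v $ k\<close>. So this column alone is a maximal
  independent set of columns.\<close>

lemma rank_outer_mat:
  assumes v: "v \<in> carrier_vec n" and k: "k < n" "v $ k \<noteq> 0"
  shows "vec_space.rank n (outer_mat v) = 1"
proof -
  interpret vec_space "TYPE(complex)" n .
  let ?A = "outer_mat v"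
  note A = outer_mat_carrier[OF v]
  define u where "u = col ?A k"
  have u: "u \<in> carrier_vec n" "u \<in> set (cols ?A)"
    using A k by (auto simp: u_def cols_def)
  have "u $ k \<noteq> 0"
    using k A by (simp add: u_def outer_mat_index[OF v])
  have "maximal {u} (\<lambda>T. T \<subseteq> set (cols ?A) \<and> lin_indpt T)"
    unfolding maximal_def
  proof (intro conjI allI impI)
    show "{u} \<subseteq> set (cols ?A)" using u by simp
    show "lin_indpt {u}"
    proof (rule finite_lin_indpt2)
      fix a
      assume "lincomb a {u} = 0\<^sub>v n"
      then have "lincomb a {u} $ k = 0" using k by simp
      then show "\<forall>w\<in>{u}. a w = 0"
        using \<open>u $ k \<noteq> 0\<close> k u by (simp add: lincomb_index)
    qed (use u in auto)
    fix T
    assume T: "T \<supseteq> {u} \<and> T \<subseteq> set (cols ?A) \<and> lin_indpt T"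
    have "w = u" if "w \<in> T" for w
    proof (rule ccontr)
      assume "w \<noteq> u"
      from that T obtain j where j: "j < n" "w = col ?A j"
        using A by (auto simp: cols_def)
      define c where "c = cnj (v $ j) / cnj (v $ k)"
      have w: "w = c \<cdot>\<^sub>v u"
        unfolding j u_def c_def using k j(1) A by (intro eq_vecI) (auto simp: outer_mat_index[OF v])
      \<comment> \<open>The nontrivial relation c u - w = 0.\<close>
      define a where "a = (\<lambda>x. if x = u then c else - 1)"
      have "lincomb a {u, w} = 0\<^sub>v n"
      proof (rule eq_vecI)
        fix i
        assume "i < dim_vec (0\<^sub>v n :: complex vec)"
        then have "i < n" by simp
        then show "lincomb a {u, w} $ i = 0\<^sub>v n $ i"
          using \<open>w \<noteq> u\<close> u by (subst lincomb_index) (auto simp: a_def w)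
      qed (use u in \<open>auto simp: w lincomb_dim\<close>)
      then have "lin_dep T"
        using T that \<open>w \<noteq> u\<close> by (intro lin_dep_crit[where A = "{u, w}" and a = a and v = w]) (auto simp: a_def)
      then show False using T by blast
    qed
    then show "T = {u}" using T by auto
  qed
  then show ?thesis
    using rank_card_indpt[OF A] by simp
qed

section \<open>The semidefinite program in coordinates\<close>

text \<open>The constraint matrices are real and diagonal, so the traces reduce to the diagonal of
  \<open>A\<close>, which is real. Off-diagonal entries may thus be changed freely as long as the
  matrix stays positive semidefinite.\<close>

lemma sdp_feasible_iff:
  assumes h: "h \<in> carrier_vec N"
  shows "sdp_feasible h \<sigma>\<theta> \<sigma>v \<sigma>w PT A \<longleftrightarrow>
    psd_mat (N + 1) A \<and>
    (\<Sum>i<N. Re (A $$ (i, i)) * ((cmod (h $ i))\<^sup>2 * (\<sigma>v i)\<^sup>2)) + Re (A $$ (N, N)) * \<sigma>w\<^sup>2 = 1 \<and>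
    (\<forall>i<N. Re (A $$ (i, i)) * (\<sigma>\<theta>\<^sup>2 + (\<sigma>v i)\<^sup>2) \<le> PT i * Re (A $$ (N, N)))"
proof (cases "psd_mat (N + 1) A")
  case True
  then have A: "A \<in> carrier_mat (N + 1) (N + 1)"
    by (rule psd_mat_carrier)
  have real: "A $$ (i, i) = complex_of_real (Re (A $$ (i, i)))" if "i \<le> N" for i
    using psd_mat_diag(1)[OF True] that by simp
  have dim: "dim_vec h = N" using h by simp
  \<comment> \<open>One formula serves both \<open>C_bar\<close> and \<open>D_bar\<close>, each a
    bordered real diagonal matrix.\<close>
  have trace: "mat_trace (A * border_mat N (mat_diag N (\<lambda>i. complex_of_real (f i))) c) =
      complex_of_real ((\<Sum>i<N. Re (A $$ (i, i)) * f i) + Re (A $$ (N, N)) * c)" for f c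
  proof -
    have "(\<Sum>j<N. A $$ (i, j) * mat_diag N (\<lambda>i. complex_of_real (f i)) $$ (j, i)) =
        complex_of_real (Re (A $$ (i, i)) * f i)" if "i < N" for i
    proof -
      have "(\<Sum>j<N. A $$ (i, j) * mat_diag N (\<lambda>i. complex_of_real (f i)) $$ (j, i)) =
          (\<Sum>j<N. if j = i then A $$ (i, i) * complex_of_real (f i) else 0)"
        using that by (intro sum.cong) (auto simp: mat_diag_def)
      then show ?thesis using that real[of i] by simp
    qed
    then show ?thesis
      using real[of N] by (simp add: mat_trace_mult_border_mat[OF A mat_diag_dim])
  qed
  have C: "mat_trace (A * C_bar h \<sigma>v \<sigma>w) = complex_of_real
      ((\<Sum>i<N. Re (A $$ (i, i)) * ((cmod (h $ i))\<^sup>2 * (\<sigma>v i)\<^sup>2)) + Re (A $$ (N, N)) * \<sigma>w\<^sup>2)"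
    unfolding C_bar_def HVH_eq dim by (rule trace)
  have D: "Re (mat_trace (A * D_bar N \<sigma>\<theta> \<sigma>v PT i)) =
      Re (A $$ (i, i)) * (\<sigma>\<theta>\<^sup>2 + (\<sigma>v i)\<^sup>2) - PT i * Re (A $$ (N, N))" if "i < N" for i
  proof -
    have "D_mat N \<sigma>\<theta> \<sigma>v i =
        mat_diag N (\<lambda>k. complex_of_real (if k = i then \<sigma>\<theta>\<^sup>2 + (\<sigma>v i)\<^sup>2 else 0))"
      by (auto simp: D_mat_def intro!: arg_cong[where f = "mat_diag N"])
    moreover have "(\<Sum>k<N. Re (A $$ (k, k)) * (if k = i then \<sigma>\<theta>\<^sup>2 + (\<sigma>v i)\<^sup>2 else 0)) =
        Re (A $$ (i, i)) * (\<sigma>\<theta>\<^sup>2 + (\<sigma>v i)\<^sup>2)"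
      using that by (simp add: if_distrib cong: if_cong)
    ultimately show ?thesis
      by (simp add: D_bar_def trace)
  qed
  show ?thesis
    unfolding sdp_feasible_def dim C of_real_eq_1_iff using True D by auto
qed (use h in \<open>simp add: sdp_feasible_def\<close>)

lemma trace_mult_H_bar:
  assumes "h \<in> carrier_vec N" and "A \<in> carrier_mat (N + 1) (N + 1)"
  shows "mat_trace (A * H_bar h) = (\<Sum>i<N. \<Sum>j<N. A $$ (i, j) * (h $ j * cnj (h $ i)))"
  using assms mat_trace_mult_border_mat[OF assms(2) outer_mat_carrier[OF assms(1)], of 0]
  by (simp add: H_bar_def outer_mat_index[OF assms(1)])

text \<open>The double sum factors as a number times its conjugate. Only the leading block is
  prescribed, since \<open>H_bar\<close> vanishes in the last row and column; so this also applies
  to an optimal \<open>A\<close> whose last column is unknown.\<close>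

lemma trace_mult_H_bar_outer:
  assumes h: "h \<in> carrier_vec N" and A: "A \<in> carrier_mat (N + 1) (N + 1)"
    and A_eq: "\<And>i j. i < N \<Longrightarrow> j < N \<Longrightarrow> A $$ (i, j) = v i * cnj (v j)"
  shows "Re (mat_trace (A * H_bar h)) = (cmod (\<Sum>i<N. h $ i * cnj (v i)))\<^sup>2"
proof -
  have "mat_trace (A * H_bar h) = complex_of_real ((cmod (\<Sum>i<N. h $ i * cnj (v i)))\<^sup>2)"
    unfolding trace_mult_H_bar[OF h A] complex_norm_square
    using A_eq by (subst mult.commute) (auto simp: sum_product intro!: sum.cong)
  then show ?thesis by simp
qed

section \<open>The MSE as a function of the signal-to-noise ratio\<close>

text \<open>The real value of the form \<open>x^H h h^H x\<close>; \<open>noise_gain\<close> is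
  likewise that of \<open>x^H H V H^H x\<close>.\<close>

definition signal_gain :: "complex vec \<Rightarrow> complex vec \<Rightarrow> real" where
  "signal_gain h x = (cmod (\<Sum>i<dim_vec h. h $ i * cnj (x $ i)))\<^sup>2"

definition noise_gain :: "complex vec \<Rightarrow> (nat \<Rightarrow> real) \<Rightarrow> complex vec \<Rightarrow> real" where
  "noise_gain h \<sigma>v x = (\<Sum>i<dim_vec h. (cmod (x $ i))\<^sup>2 * ((cmod (h $ i))\<^sup>2 * (\<sigma>v i)\<^sup>2))"

lemma noise_gain_nonneg: "noise_gain h \<sigma>v x \<ge> 0"
  by (simp add: noise_gain_def sum_nonneg)

lemma MSE_eq:
  assumes "h \<in> carrier_vec N" and "x \<in> carrier_vec N"
  shows "MSE h \<sigma>v \<sigma>w P x =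
    (1 - P * signal_gain h x / (noise_gain h \<sigma>v x + P * signal_gain h x + \<sigma>w\<^sup>2)) * P"
proof -
  have "quad_form (HVH h \<sigma>v) x = complex_of_real (noise_gain h \<sigma>v x)"
    using assms by (simp add: HVH_eq quad_form_mat_diag noise_gain_def mult_ac)
  then show ?thesis
    using assms by (simp add: MSE_def quad_form_outer_mat[OF assms] signal_gain_def)
qed

text \<open>With signal power S and total noise power V the MSE equals P V / (V + P S) = P / (1 + P
  S / V), which decreases in S / V.\<close>

lemma MSE_antimono:
  assumes h: "h \<in> carrier_vec N" and x: "x \<in> carrier_vec N" and y: "y \<in> carrier_vec N"
    and w: "\<sigma>w\<^sup>2 > 0" and P: "P > 0"
    and le: "signal_gain h x / (noise_gain h \<sigma>v x + \<sigma>w\<^sup>2) \<le>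
      signal_gain h y / (noise_gain h \<sigma>v y + \<sigma>w\<^sup>2)"
  shows "MSE h \<sigma>v \<sigma>w P y \<le> MSE h \<sigma>v \<sigma>w P x"
proof -
  define S S' V V' where "S = signal_gain h x" and "S' = signal_gain h y"
    and "V = noise_gain h \<sigma>v x + \<sigma>w\<^sup>2" and "V' = noise_gain h \<sigma>v y + \<sigma>w\<^sup>2"
  have V: "V > 0" "V' > 0" and S: "S \<ge> 0" "S' \<ge> 0"
    using w noise_gain_nonneg[of h \<sigma>v] by (simp_all add: V_def V'_def S_def S'_def signal_gain_def add_nonneg_pos)
  have "S * V' \<le> S' * V"
    using le V by (simp add: field_simps flip: S_def S'_def V_def V'_def)
  then have "P * (S * V') \<le> P * (S' * V)"
    using P by simp
  moreover have "V + P * S > 0" "V' + P * S' > 0"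
    using V S P by (simp_all add: add_pos_nonneg)
  \<comment> \<open>After cross-multiplication the common term P S P S' cancels.\<close>
  ultimately have "P * S / (V + P * S) \<le> P * S' / (V' + P * S')"
    by (simp add: field_simps)
  then show ?thesis
    using P unfolding MSE_eq[OF h x] MSE_eq[OF h y] S_def S'_def V_def V'_def
    by (intro mult_right_mono) (simp_all add: add_ac)
qed

section \<open>From gain vectors to feasible matrices\<close>

text \<open>With \<open>c\<close> the reciprocal of the noise power, scaling \<open>x\<close> by the
  root of \<open>c\<close> and putting \<open>c\<close> in the last corner turns the denominator
  into the normalisation constraint and multiplies each power constraint by \<open>c\<close>. The
  objective at this matrix is exactly the ratio.\<close>

lemma sdp_value_ge:
  assumes h: "h \<in> carrier_vec N" and w: "\<sigma>w\<^sup>2 > 0"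
    and opt: "sdp_optimal h \<sigma>\<theta> \<sigma>v \<sigma>w PT A" and x: "power_feasible N \<sigma>\<theta> \<sigma>v PT x"
  shows "signal_gain h x / (noise_gain h \<sigma>v x + \<sigma>w\<^sup>2) \<le> Re (mat_trace (A * H_bar h))"
proof -
  define c where "c = 1 / (noise_gain h \<sigma>v x + \<sigma>w\<^sup>2)"
  have "noise_gain h \<sigma>v x + \<sigma>w\<^sup>2 > 0"
    using w noise_gain_nonneg[of h \<sigma>v x] by linarith
  then have c: "c > 0" "c * (noise_gain h \<sigma>v x + \<sigma>w\<^sup>2) = 1"
    by (simp_all add: c_def)
  define y where "y = complex_of_real (sqrt c) \<cdot>\<^sub>v x"
  define B where "B = border_mat N (outer_mat y) c"
  have x': "x \<in> carrier_vec N" and dim: "dim_vec h = N"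
    and le: "\<And>i. i < N \<Longrightarrow> (cmod (x $ i))\<^sup>2 * (\<sigma>\<theta>\<^sup>2 + (\<sigma>v i)\<^sup>2) \<le> PT i"
    using x h by (auto simp: power_feasible_def)
  have y: "y \<in> carrier_vec N" using x' by (simp add: y_def)
  note oc = outer_mat_carrier[OF y]
  have B: "B \<in> carrier_mat (N + 1) (N + 1)"
    and B_out: "\<And>i j. i < N \<Longrightarrow> j < N \<Longrightarrow> B $$ (i, j) = y $ i * cnj (y $ j)"
    and B_N: "B $$ (N, N) = complex_of_real c"
    using border_mat_carrier[OF oc] border_mat_index[OF oc] outer_mat_index[OF y]
    by (simp_all add: B_def)
  have B_diag: "Re (B $$ (i, i)) = c * (cmod (x $ i))\<^sup>2" if "i < N" for i
  proof -
    have "B $$ (i, i) = complex_of_real ((cmod (y $ i))\<^sup>2)"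
      unfolding complex_norm_square using that by (simp add: B_out)
    then show ?thesis
      using that x' c by (simp add: y_def norm_mult power_mult_distrib)
  qed
  have "sdp_feasible h \<sigma>\<theta> \<sigma>v \<sigma>w PT B"
    unfolding sdp_feasible_iff[OF h]
  proof (intro conjI allI impI)
    show "psd_mat (N + 1) B"
      unfolding B_def using y c by (intro psd_mat_border_outer_mat) auto
    show "(\<Sum>i<N. Re (B $$ (i, i)) * ((cmod (h $ i))\<^sup>2 * (\<sigma>v i)\<^sup>2)) + Re (B $$ (N, N)) * \<sigma>w\<^sup>2 = 1"
      using c(2) by (simp add: B_diag B_N noise_gain_def dim sum_distrib_left algebra_simps)
    show "Re (B $$ (i, i)) * (\<sigma>\<theta>\<^sup>2 + (\<sigma>v i)\<^sup>2) \<le> PT i * Re (B $$ (N, N))" if "i < N" for i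
      using mult_left_mono[OF le[OF that], of c] c(1) that by (simp add: B_diag B_N mult_ac)
  qed
  then have "Re (mat_trace (B * H_bar h)) \<le> Re (mat_trace (A * H_bar h))"
    using opt by (auto simp: sdp_optimal_def is_arg_max_def not_less)
  moreover have "Re (mat_trace (B * H_bar h)) = c * signal_gain h x"
  proof -
    have "(\<Sum>i<N. h $ i * cnj (y $ i)) = complex_of_real (sqrt c) * (\<Sum>i<N. h $ i * cnj (x $ i))"
      using x' by (simp add: y_def sum_distrib_left mult_ac)
    then show ?thesis
      using c by (simp add: trace_mult_H_bar_outer[OF h B B_out] signal_gain_def dim norm_mult
          power_mult_distrib)
  qed
  ultimately show ?thesis by (simp add: c_def)
qed

text \<open>Sensor \<open>k\<close> transmitting alone at its full power budget already achieves a
  positive ratio. This will exclude a zero leading block.\<close>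

lemma sdp_value_pos:
  assumes h: "h \<in> carrier_vec N" and w: "\<sigma>w\<^sup>2 > 0"
    and opt: "sdp_optimal h \<sigma>\<theta> \<sigma>v \<sigma>w PT A"
    and k: "k < N" "h $ k \<noteq> 0" and pos: "\<sigma>\<theta>\<^sup>2 > 0" "\<And>i. i < N \<Longrightarrow> PT i > 0"
  shows "Re (mat_trace (A * H_bar h)) > 0"
proof -
  define r where "r = sqrt (PT k / (\<sigma>\<theta>\<^sup>2 + (\<sigma>v k)\<^sup>2))"
  define x where "x = complex_of_real r \<cdot>\<^sub>v unit_vec N k"
  have d: "\<sigma>\<theta>\<^sup>2 + (\<sigma>v k)\<^sup>2 > 0"
    using pos(1) by (simp add: add_pos_nonneg)
  then have "PT k / (\<sigma>\<theta>\<^sup>2 + (\<sigma>v k)\<^sup>2) > 0"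
    using pos(2)[OF k(1)] by (intro divide_pos_pos)
  then have "r > 0" and "r\<^sup>2 = PT k / (\<sigma>\<theta>\<^sup>2 + (\<sigma>v k)\<^sup>2)"
    by (simp_all add: r_def)
  then have r: "r > 0" "r\<^sup>2 * (\<sigma>\<theta>\<^sup>2 + (\<sigma>v k)\<^sup>2) = PT k"
    using d by (auto simp del: sum_power2_gt_zero_iff)
  have xi: "x $ i = (if i = k then complex_of_real r else 0)" if "i < N" for i
    using that k by (simp add: x_def)
  have x: "power_feasible N \<sigma>\<theta> \<sigma>v PT x"
    unfolding power_feasible_def
  proof (intro conjI allI impI)
    show x_carrier: "x \<in> carrier_vec N" by (simp add: x_def)
    show "(cmod (conjugate x $ i))\<^sup>2 * (\<sigma>\<theta>\<^sup>2 + (\<sigma>v i)\<^sup>2) \<le> PT i" if "i < N" for i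
      using that r x_carrier pos(2)[OF that] by (cases "i = k") (simp_all add: xi)
  qed
  have "(\<Sum>i<N. h $ i * cnj (x $ i)) = (\<Sum>i<N. if i = k then h $ k * complex_of_real r else 0)"
    by (intro sum.cong) (auto simp: xi)
  then have "signal_gain h x > 0"
    using h k r by (simp add: signal_gain_def)
  then have "signal_gain h x / (noise_gain h \<sigma>v x + \<sigma>w\<^sup>2) > 0"
    using w noise_gain_nonneg[of h \<sigma>v x] by (simp add: add_nonneg_pos)
  then show ?thesis
    using sdp_value_ge[OF h w opt x] by linarith
qed

section \<open>The leading block of an optimal matrix\<close>

lemma sdp_optimal_entries:
  assumes h: "h \<in> carrier_vec N" and h0: "\<And>i. i < N \<Longrightarrow> h $ i \<noteq> 0"
    and opt: "sdp_optimal h \<sigma>\<theta> \<sigma>v \<sigma>w PT A" and ij: "i < N" "j < N"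
  shows "A $$ (i, j) =
    (complex_of_real (sqrt (Re (A $$ (i, i)))) * sgn (h $ i)) *
    cnj (complex_of_real (sqrt (Re (A $$ (j, j)))) * sgn (h $ j))"
proof -
  define b where "b = (\<lambda>i. sqrt (Re (A $$ (i, i))))"
  \<comment> \<open>The phases make each \<open>h $ i * cnj (v $ i)\<close> real and nonnegative, so
    nothing cancels in the sum.\<close>
  define v where "v = vec N (\<lambda>i. complex_of_real (b i) * sgn (h $ i))"
  define B where "B = border_mat N (outer_mat v) (Re (A $$ (N, N)))"
  have feas: "sdp_feasible h \<sigma>\<theta> \<sigma>v \<sigma>w PT A"
    using opt by (simp add: sdp_optimal_def is_arg_max_def)
  then have psd: "psd_mat (N + 1) A"
    by (simp add: sdp_feasible_iff[OF h])
  then have A: "A \<in> carrier_mat (N + 1) (N + 1)"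
    by (rule psd_mat_carrier)
  have nonneg: "Re (A $$ (i, i)) \<ge> 0" if "i \<le> N" for i
    using psd_mat_diag(2)[OF psd] that by simp
  have v: "v \<in> carrier_vec N" by (simp add: v_def)
  note oc = outer_mat_carrier[OF v]
  have B: "B \<in> carrier_mat (N + 1) (N + 1)"
    and B_out: "\<And>i j. i < N \<Longrightarrow> j < N \<Longrightarrow> B $$ (i, j) = v $ i * cnj (v $ j)"
    and B_N: "B $$ (N, N) = complex_of_real (Re (A $$ (N, N)))"
    using border_mat_carrier[OF oc] border_mat_index[OF oc] outer_mat_index[OF v]
    by (simp_all add: B_def)
  have B_diag: "Re (B $$ (i, i)) = Re (A $$ (i, i))" if "i < N" for i
  proof -
    have "B $$ (i, i) = complex_of_real ((cmod (v $ i))\<^sup>2)"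
      unfolding complex_norm_square using that by (simp add: B_out)
    then show ?thesis
      using that nonneg[of i] h0[of i] by (simp add: v_def b_def norm_mult norm_sgn)
  qed
  have "psd_mat (N + 1) B"
    unfolding B_def using v nonneg by (intro psd_mat_border_outer_mat) auto
  then have "sdp_feasible h \<sigma>\<theta> \<sigma>v \<sigma>w PT B"
    using feas by (simp add: sdp_feasible_iff[OF h] B_diag B_N)
  then have B_le: "Re (mat_trace (B * H_bar h)) \<le> Re (mat_trace (A * H_bar h))"
    using opt by (auto simp: sdp_optimal_def is_arg_max_def not_less)
  define z where "z = (\<lambda>i j. A $$ (i, j) * (h $ j * cnj (h $ i)))"
  define g where "g = (\<lambda>i j. (cmod (h $ i) * b i) * (cmod (h $ j) * b j))"
  \<comment> \<open>The modulus, not just the real part, is bounded: this later kills the imaginary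
    part.\<close>
  have z_le: "cmod (z i j) \<le> g i j" if "i < N" "j < N" for i j
    using mult_right_mono[OF psd_mat_entry_bound[OF psd, of i j], of "cmod (h $ j) * cmod (h $ i)"] that
    by (simp add: z_def g_def b_def norm_mult mult_ac)
  have "(\<Sum>i<N. h $ i * cnj (v $ i)) = complex_of_real (\<Sum>i<N. cmod (h $ i) * b i)"
    unfolding of_real_sum
  proof (intro sum.cong refl)
    fix i
    assume "i \<in> {..<N}"
    moreover have "h $ i * cnj (sgn (h $ i)) = complex_of_real (cmod (h $ i))"
      using complex_norm_square[of "h $ i"]
      by (cases "h $ i = 0") (simp_all add: sgn_eq power2_eq_square nonzero_divide_eq_eq)
    ultimately show "h $ i * cnj (v $ i) = complex_of_real (cmod (h $ i) * b i)"
      by (simp add: v_def mult.left_commute)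
  qed
  then have "Re (mat_trace (B * H_bar h)) = (\<Sum>i<N. cmod (h $ i) * b i)\<^sup>2"
    using trace_mult_H_bar_outer[OF h B, of "\<lambda>i. v $ i", OF B_out]
    by (simp del: of_real_sum)
  then have "Re (mat_trace (B * H_bar h)) = (\<Sum>i<N. \<Sum>j<N. g i j)"
    by (simp add: power2_eq_square sum_product g_def)
  then have "(\<Sum>i<N. \<Sum>j<N. g i j) \<le> (\<Sum>i<N. \<Sum>j<N. Re (z i j))"
    using B_le by (simp add: trace_mult_H_bar[OF h A] z_def)
  then have "(\<Sum>(i, j)\<in>{..<N} \<times> {..<N}. g i j) \<le> (\<Sum>(i, j)\<in>{..<N} \<times> {..<N}. Re (z i j))"
    by (simp add: sum.cartesian_product)
  moreover have Re_le: "Re (z i j) \<le> g i j" if "i < N" "j < N" for i j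
    using z_le[OF that] complex_Re_le_cmod[of "z i j"] by linarith
  then have "(\<Sum>(i, j)\<in>{..<N} \<times> {..<N}. Re (z i j)) \<le> (\<Sum>(i, j)\<in>{..<N} \<times> {..<N}. g i j)"
    by (intro sum_mono) auto
  ultimately have "(\<Sum>p\<in>{..<N} \<times> {..<N}. Re (z (fst p) (snd p))) =
      (\<Sum>p\<in>{..<N} \<times> {..<N}. g (fst p) (snd p))"
    by (simp add: case_prod_beta)
  \<comment> \<open>Termwise inequality together with equal sums gives equality in every
    term.\<close>
  from sum_mono_inv[OF this, of "(i, j)"] have "Re (z i j) = g i j"
    using Re_le ij by auto
  \<comment> \<open>A number whose modulus is at most its real part is real.\<close>
  moreover from this have "Im (z i j) = 0"
    using z_le[OF ij] by (metis abs_Re_le_cmod abs_ge_self cmod_eq_Re cmod_power2 order_antisym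
        add_cancel_left_right complex_Re_le_cmod power2_eq_iff zero_eq_power2)
  ultimately have "z i j = complex_of_real (g i j)"
    by (simp add: complex_eq_iff)
  then have "A $$ (i, j) = complex_of_real (g i j) / (h $ j * cnj (h $ i))"
    using h0 ij by (simp add: z_def field_simps)
  \<comment> \<open>Dividing by \<open>h $ j * cnj (h $ i)\<close> leaves |h_i| / cnj h_i, which is
    \<open>sgn (h $ i)\<close>, and |h_j| / h_j, which is the conjugate of
    \<open>sgn (h $ j)\<close>.\<close>
  moreover have "sgn w = complex_of_real (cmod w) / cnj w" if "w \<noteq> 0" for w
    using that by (simp add: sgn_eq field_simps flip: complex_norm_square power2_eq_square)
  ultimately show ?thesis
    using h0 ij by (simp add: g_def b_def mult_ac)
qed

section \<open>Scaling an optimal matrix back to a gain vector\<close>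

theorem theorem1:
  fixes N :: nat
    and h :: "complex vec"
    and \<sigma>\<theta> \<sigma>w P :: real
    and \<sigma>v PT :: "nat \<Rightarrow> real"
    and A :: "complex mat"
  assumes "N \<ge> 1"
    and "h \<in> carrier_vec N"
    and "\<And>i. i < N \<Longrightarrow> h $ i \<noteq> 0"
    and "\<sigma>\<theta>\<^sup>2 > 0"
    and "\<sigma>w\<^sup>2 > 0"
    and "\<And>i. i < N \<Longrightarrow> (\<sigma>v i)\<^sup>2 > 0"
    and "\<And>i. i < N \<Longrightarrow> PT i > 0"
    and "P > 0"
    and "sdp_optimal h \<sigma>\<theta> \<sigma>v \<sigma>w PT A"
  shows "vec_space.rank N (submatrix A {..<N} {..<N}) = 1 \<and>
    (\<exists>a \<in> carrier_vec N. submatrix A {..<N} {..<N} = outer_mat a) \<and>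
    (\<forall>a \<in> carrier_vec N. submatrix A {..<N} {..<N} = outer_mat a \<longrightarrow>
       mse_optimal h \<sigma>\<theta> \<sigma>v \<sigma>w PT P
         (complex_of_real (1 / sqrt (Re (A $$ (N, N)))) \<cdot>\<^sub>v a))"
proof -
  note h = assms(2) and w = assms(5) and opt = assms(9)
  have dim: "dim_vec h = N" using h by simp
  have feas: "sdp_feasible h \<sigma>\<theta> \<sigma>v \<sigma>w PT A"
    using opt by (simp add: sdp_optimal_def is_arg_max_def)
  then have psd: "psd_mat (N + 1) A"
    and trace: "(\<Sum>i<N. Re (A $$ (i, i)) * ((cmod (h $ i))\<^sup>2 * (\<sigma>v i)\<^sup>2)) +
      Re (A $$ (N, N)) * \<sigma>w\<^sup>2 = 1"
    and power: "\<And>i. i < N \<Longrightarrow> Re (A $$ (i, i)) * (\<sigma>\<theta>\<^sup>2 + (\<sigma>v i)\<^sup>2) \<le> PT i * Re (A $$ (N, N))"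
    by (simp_all add: sdp_feasible_iff[OF h])
  have A: "A \<in> carrier_mat (N + 1) (N + 1)"
    by (rule psd_mat_carrier[OF psd])
  have sub: "submatrix A {..<N} {..<N} = mat N N (\<lambda>ij. A $$ ij)"
    using A by (intro submatrix_lessThan) auto
  have nonneg: "Re (A $$ (i, i)) \<ge> 0" if "i \<le> N" for i
    using psd_mat_diag(2)[OF psd] that by simp
  define t where "t = Re (A $$ (N, N))"
  \<comment> \<open>If \<open>t\<close> were 0, the power constraints would make the whole diagonal
    vanish and the normalisation would read 0 = 1.\<close>
  have "t \<noteq> 0"
  proof
    assume "t = 0"
    have "Re (A $$ (i, i)) = 0" if "i < N" for i
    proof -
      have "\<sigma>\<theta>\<^sup>2 + (\<sigma>v i)\<^sup>2 > 0" using assms(4) by (simp add: add_pos_nonneg)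
      then show ?thesis
        using power[OF that] nonneg[of i] that \<open>t = 0\<close>
        by (simp add: t_def mult_le_0_iff)
    qed
    then show False using trace \<open>t = 0\<close> by (simp add: t_def)
  qed
  then have t: "t > 0" using nonneg[of N] by (simp add: t_def)
  \<comment> \<open>Shown for every factor \<open>a\<close>, since the block determines
    \<open>a\<close> only up to a phase.\<close>
  have mse: "mse_optimal h \<sigma>\<theta> \<sigma>v \<sigma>w PT P (complex_of_real (1 / sqrt t) \<cdot>\<^sub>v a)"
    if a: "a \<in> carrier_vec N" and eq: "submatrix A {..<N} {..<N} = outer_mat a" for a
  proof -
    define x where "x = complex_of_real (1 / sqrt t) \<cdot>\<^sub>v a"
    have x: "x \<in> carrier_vec N" using a by (simp add: x_def)
    have A_out: "A $$ (i, j) = a $ i * cnj (a $ j)" if "i < N" "j < N" for i j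
      using arg_cong[OF eq, of "\<lambda>M. M $$ (i, j)"] that by (simp add: sub outer_mat_index[OF a])
    have x_norm: "(cmod (x $ i))\<^sup>2 = Re (A $$ (i, i)) / t" if "i < N" for i
    proof -
      have "A $$ (i, i) = complex_of_real ((cmod (a $ i))\<^sup>2)"
        unfolding complex_norm_square using that by (simp add: A_out)
      then show ?thesis
        using that a t by (simp add: x_def norm_mult norm_divide power_divide power_mult_distrib)
    qed
    have "power_feasible N \<sigma>\<theta> \<sigma>v PT x"
      using x power t by (auto simp: power_feasible_def x_norm t_def field_simps)
    \<comment> \<open>The normalisation makes \<open>t\<close> the reciprocal of the noise power at
      \<open>x\<close>, so the scaling is undone and \<open>x\<close> attains the optimum of the
      semidefinite program, which bounds the ratio of every feasible vector.\<close>
    moreover have "signal_gain h x / (noise_gain h \<sigma>v x + \<sigma>w\<^sup>2) = Re (mat_trace (A * H_bar h))"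
    proof -
      have "t * (noise_gain h \<sigma>v x + \<sigma>w\<^sup>2) = 1"
        using trace t by (simp add: noise_gain_def dim x_norm sum_distrib_left distrib_left t_def mult.commute)
      then have "noise_gain h \<sigma>v x + \<sigma>w\<^sup>2 = 1 / t"
        using t by (simp add: field_simps)
      moreover have "(\<Sum>i<N. h $ i * cnj (x $ i)) =
          complex_of_real (1 / sqrt t) * (\<Sum>i<N. h $ i * cnj (a $ i))"
        using a by (simp add: x_def sum_distrib_left mult_ac)
      then have "signal_gain h x = Re (mat_trace (A * H_bar h)) / t"
        using t by (simp add: trace_mult_H_bar_outer[OF h A A_out] signal_gain_def dim norm_mult
          norm_divide power_divide)
      ultimately show ?thesis using t by simp
    qed
    ultimately show ?thesis
      unfolding mse_optimal_def is_arg_min_linorder dim x_def[symmetric]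
      using MSE_antimono[OF h _ x w \<open>P > 0\<close>] sdp_value_ge[OF h w opt]
      by (auto simp: power_feasible_def)
  qed
  define a where "a = vec N (\<lambda>i. complex_of_real (sqrt (Re (A $$ (i, i)))) * sgn (h $ i))"
  have a: "a \<in> carrier_vec N" by (simp add: a_def)
  have A_out: "A $$ (i, j) = a $ i * cnj (a $ j)" if "i < N" "j < N" for i j
    using sdp_optimal_entries[OF h assms(3) opt that] that by (simp add: a_def)
  have eq: "submatrix A {..<N} {..<N} = outer_mat a"
    unfolding sub using outer_mat_carrier[OF a]
    by (intro eq_matI) (auto simp: A_out outer_mat_index[OF a])
  \<comment> \<open>A zero factor would give objective 0, against the positive value that sensor 0
    secures; hence the rank is not 0.\<close>
  have "\<exists>k<N. a $ k \<noteq> 0"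
  proof (rule ccontr)
    assume "\<not> (\<exists>k<N. a $ k \<noteq> 0)"
    then have "Re (mat_trace (A * H_bar h)) = 0"
      by (simp add: trace_mult_H_bar_outer[OF h A A_out])
    then show False
      using sdp_value_pos[OF h w opt, of 0] assms(1,3,4,7) by simp
  qed
  then have "vec_space.rank N (submatrix A {..<N} {..<N}) = 1"
    using rank_outer_mat[OF a] eq by auto
  then show ?thesis
    using a eq mse by (auto simp: t_def)
qed

end
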